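(* Let $S$ be an Armendariz semiring. Then $S$ is reversible if and only if the polynomial semiring $S[X]$ is reversible.
   Context: A semiring is an algebraic structure $(S,+,\cdot,0,1)$ such that $(S,+,0)$ is a commutative monoid, $(S,\cdot,1)$ is a (not necessarily commutative) monoid with $1\neq 0$, $a(b+c)=ab+ac$ and $(b+c)a=ba+ca$ for all $a,b,c\in S$, and $a\cdot 0=0\cdot a=0$ for all $a\in S$. A semiring is reversible if $st=0$ implies $ts=0$ for all its elements $s,t$. $S[X]$ is the polynomial semiring in an indeterminate $X$ commuting with the coefficients. $S$ is Armendariz if whenever $f=\sum_{i=0}^m a_iX^i$ and $g=\sum_{j=0}^n b_jX^j$ in $S[X]$ satisfy $fg=0$, then $a_ib_j=0$ for all $0\le i\le m$ and $0\le j\le n$. *)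

theory Defs
  imports "HOL-Library.Poly_Mapping"
begin

text \<open>
  A semiring in the sense used here (not necessarily commutative, with \<open>1 \<noteq> 0\<close> and absorbing zero)
  is a type of class \<^class>\<open>semiring_1\<close>.  The type \<open>'a poly\<close> of the library only multiplies
  polynomials over commutative semirings, so the polynomial semiring \<open>S[X]\<close> is rendered by finitely
  supported functions from exponents to coefficients with the convolution product;
  \<open>Poly_Mapping.single i a\<close> is the monomial \<open>a X\<^sup>i\<close>, and the indeterminate \<open>Poly_Mapping.single 1 1\<close>
  commutes with the constants \<open>Poly_Mapping.single 0 a\<close>.
\<close>

type_synonym 'a polynomial = "nat \<Rightarrow>\<^sub>0 'a"

definition reversible :: "'a::semiring_1 itself \<Rightarrow> bool" where
  "reversible _ \<longleftrightarrow> (\<forall>s t :: 'a. s * t = 0 \<longrightarrow> t * s = 0)"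

definition armendariz :: "'a::semiring_1 itself \<Rightarrow> bool" where
  "armendariz _ \<longleftrightarrow>
    (\<forall>(m::nat) (n::nat) (a :: nat \<Rightarrow> 'a) (b :: nat \<Rightarrow> 'a).
      ((\<Sum>i=0..m. Poly_Mapping.single i (a i)) * (\<Sum>j=0..n. Poly_Mapping.single j (b j))
          :: 'a polynomial) = 0 \<longrightarrow>
      (\<forall>i\<in>{0..m}. \<forall>j\<in>{0..n}. a i * b j = 0))"

end

theory Submission
  imports Defs
begin

text \<open>If fg = 0, the Armendariz property kills every product a_i b_j of coefficients, not just
  the convolution sums. Reversibility of S turns each of these into b_j a_i = 0, and gf is built
  from such products alone, so gf = 0 (\<open>armendariz_reversible_polynomial\<close>). Conversely,
  S embeds in S[X] as the constants, so reversibility passes down to S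
  (\<open>reversible_polynomial_imp\<close>).\<close>

lemma polynomial_expansion:
  fixes f :: "'a::comm_monoid_add polynomial"
  assumes "Poly_Mapping.keys f \<subseteq> {0..m}"
  shows "f = (\<Sum>i=0..m. Poly_Mapping.single i (Poly_Mapping.lookup f i))"
proof (rule poly_mapping_eqI)
  fix k
  have "Poly_Mapping.lookup f k = 0" if "k \<notin> {0..m}"
    using assms that by (auto simp: in_keys_iff)
  then show "Poly_Mapping.lookup f k =
      Poly_Mapping.lookup (\<Sum>i=0..m. Poly_Mapping.single i (Poly_Mapping.lookup f i)) k"
    by (auto simp: lookup_sum lookup_single when_def sum.delta)
qed

text \<open>Bridges finitely supported functions and the explicit sums in \<open>armendariz\<close>.
  The bound \<open>m\<close> need not be the degree, so the zero polynomial is no special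
  case.\<close>

lemma polynomial_expansion_ex:
  fixes f :: "'a::comm_monoid_add polynomial"
  obtains m where "f = (\<Sum>i=0..m. Poly_Mapping.single i (Poly_Mapping.lookup f i))"
proof -
  obtain m where "Poly_Mapping.keys f \<subseteq> {0..m}"
    using finite_keys[of f] unfolding finite_nat_set_iff_bounded_le by (auto simp: subset_eq)
  then show thesis
    by (rule that[OF polynomial_expansion])
qed

lemma armendariz_reversible_polynomial:
  assumes "armendariz TYPE('a::semiring_1)" and "reversible TYPE('a)"
  shows "reversible TYPE('a polynomial)"
  unfolding reversible_def
proof (intro allI impI)
  fix f g :: "'a polynomial"
  assume "f * g = 0"
  define a b where "a = Poly_Mapping.lookup f" and "b = Poly_Mapping.lookup g"
  obtain m where f: "f = (\<Sum>i=0..m. Poly_Mapping.single i (a i))"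
    unfolding a_def by (rule polynomial_expansion_ex)
  obtain n where g: "g = (\<Sum>j=0..n. Poly_Mapping.single j (b j))"
    unfolding b_def by (rule polynomial_expansion_ex)
  have "a i * b j = 0" if "i \<in> {0..m}" "j \<in> {0..n}" for i j
    using assms(1) \<open>f * g = 0\<close> that unfolding armendariz_def f g by blast
  then have "b j * a i = 0" if "i \<in> {0..m}" "j \<in> {0..n}" for i j
    using assms(2) that unfolding reversible_def by blast
  \<comment> \<open>By distributivity, gf is the double sum of the monomials
    \<open>single (j + i) (b j * a i)\<close>, each of which is zero.\<close>
  then show "g * f = 0"
    unfolding f g by (simp add: sum_product mult_single)
qed

lemma reversible_polynomial_imp:
  assumes "reversible TYPE('a::semiring_1 polynomial)"
  shows "reversible TYPE('a)"
  unfolding reversible_def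
proof (intro allI impI)
  fix s t :: 'a
  assume "s * t = 0"
  \<comment> \<open>Constants multiply as in S, and the coefficient at exponent 0 recovers the
    element, so the swap can be made in S[X] and read back.\<close>
  then have "Poly_Mapping.single (0::nat) s * Poly_Mapping.single 0 t = 0"
    by (simp add: mult_single)
  then have "Poly_Mapping.single (0::nat) t * Poly_Mapping.single 0 s = 0"
    using assms unfolding reversible_def by blast
  then have "Poly_Mapping.single (0::nat) (t * s) = 0"
    by (simp add: mult_single)
  then show "t * s = 0"
    by (metis lookup_single_eq lookup_zero)
qed

theorem theorem4p4:
  assumes "armendariz TYPE('a::semiring_1)"
  shows "reversible TYPE('a) \<longleftrightarrow> reversible TYPE('a polynomial)"
  using assms armendariz_reversible_polynomial reversible_polynomial_imp by blast

end
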